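(* Let $A$ and $B$ be disjoint sets with $|A|=a$, $|B|=b$ and $b\ge a$, and let $X=A\sqcup B$. Counting the cross inversions from $A$ to $B$ with respect to a ranking $\rho$ of $X$, i.e. computing $\mathrm{XInv}_\rho(A,B)$ from $\rho$, requires $\Omega((a+b)\log a)$ queries in the comparison-query model. The same lower bound holds for inversion minimization on the tree $T$ consisting of a root with two children, one of which has $a$ leaf children and the other of which has $b$ leaf children.
   Context: A ranking of a set $X$ of $n$ items is a bijection $\rho:X\to\{1,\dots,n\}$. For $A,B\subseteq X$, a cross inversion from $A$ to $B$ with respect to $\rho$ is a pair $(x_1,x_2)\in A\times B$ with $\rho(x_1)>\rho(x_2)$; their number is $\mathrm{XInv}_\rho(A,B)$. For a rooted tree $T$ with leaf set $X$, an ordering (left-to-right order of children at each internal node) induces a left-to-right ranking $\sigma$ of $X$; $\mathrm{MInv}(T,\rho)$ is the minimum over orderings of the number of pairs $x_1,x_2$ with $\rho(x_1)<\rho(x_2)$ and $\sigma(x_1)>\sigma(x_2)$. Inversion minimization on $T$: given $\rho$, output $\mathrm{MInv}(T,\rho)$. In the comparison-query model, an algorithm accesses $\rho$ only via queries "is $\rho(x_1)<\rho(x_2)$?"; the number of queries needed is the worst-case number of queries of the best correct deterministic algorithm. *)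

theory Defs
  imports Complex_Main "HOL-Library.Multiset"
begin

text \<open>Values of a ranking outside \<open>X\<close> are arbitrary; nothing below inspects them.\<close>

definition rankings :: "'x set \<Rightarrow> ('x \<Rightarrow> nat) set" where
  "rankings X = {\<rho>. bij_betw \<rho> X {1..card X}}"

definition XInv :: "('x \<Rightarrow> nat) \<Rightarrow> 'x set \<Rightarrow> 'x set \<Rightarrow> nat" where
  "XInv \<rho> A B = card {(x1, x2) \<in> A \<times> B. \<rho> x1 > \<rho> x2}"

definition inversions :: "'x set \<Rightarrow> ('x \<Rightarrow> nat) \<Rightarrow> ('x \<Rightarrow> nat) \<Rightarrow> nat" where
  "inversions X \<rho> \<sigma> = card {(x1, x2) \<in> X \<times> X. \<rho> x1 < \<rho> x2 \<and> \<sigma> x1 > \<sigma> x2}"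

text \<open>Rooted trees are unordered: the children of a node form a multiset. The leaf set
  of \<open>T\<close> is \<open>leaves T\<close>; leaf labels are meant to be pairwise distinct.\<close>

datatype (leaves: 'x) rtree = Leaf 'x | Node "'x rtree multiset"

text \<open>\<open>leaf_order T xs\<close>: some ordering of the children at each internal node of \<open>T\<close> makes
  \<open>xs\<close> the left-to-right sequence of leaves.\<close>

inductive leaf_order :: "'x rtree \<Rightarrow> 'x list \<Rightarrow> bool" where
  Leaf: "leaf_order (Leaf x) [x]"
| Node: "mset ts = M \<Longrightarrow> list_all2 leaf_order ts xss \<Longrightarrow> leaf_order (Node M) (concat xss)"

text \<open>The 1-based position of the (first) occurrence of \<open>x\<close> in \<open>xs\<close>.\<close>

definition list_ranking :: "'x list \<Rightarrow> 'x \<Rightarrow> nat" where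
  "list_ranking xs x = Suc (length (takeWhile (\<lambda>y. y \<noteq> x) xs))"

definition MInv :: "'x rtree \<Rightarrow> ('x \<Rightarrow> nat) \<Rightarrow> nat" where
  "MInv T \<rho> = (INF xs \<in> {xs. leaf_order T xs}. inversions (leaves T) \<rho> (list_ranking xs))"

text \<open>For finite \<open>A\<close> and \<open>B\<close> (\<open>mset_set\<close> is empty on infinite sets).\<close>

definition two_star_tree :: "'x set \<Rightarrow> 'x set \<Rightarrow> 'x rtree" where
  "two_star_tree A B =
    Node {# Node (image_mset Leaf (mset_set A)), Node (image_mset Leaf (mset_set B)) #}"

text \<open>A deterministic algorithm in the comparison-query model is a binary decision tree.
  \<open>Query x y t f\<close> asks whether \<open>\<rho> x < \<rho> y\<close> and continues with \<open>t\<close> if so, with \<open>f\<close> otherwise.\<close>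

datatype (queried: 'x, outputs: 'r) dtree =
  Output 'r
| Query 'x 'x "('x, 'r) dtree" "('x, 'r) dtree"

primrec run :: "('x, 'r) dtree \<Rightarrow> ('x \<Rightarrow> nat) \<Rightarrow> 'r" where
  "run (Output r) \<rho> = r"
| "run (Query x y t f) \<rho> = (if \<rho> x < \<rho> y then run t \<rho> else run f \<rho>)"

primrec num_queries :: "('x, 'r) dtree \<Rightarrow> ('x \<Rightarrow> nat) \<Rightarrow> nat" where
  "num_queries (Output r) \<rho> = 0"
| "num_queries (Query x y t f) \<rho> =
    Suc (if \<rho> x < \<rho> y then num_queries t \<rho> else num_queries f \<rho>)"

definition computes :: "('x, 'r) dtree \<Rightarrow> 'x set \<Rightarrow> (('x \<Rightarrow> nat) \<Rightarrow> 'r) \<Rightarrow> bool" where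
  "computes t X F \<longleftrightarrow> queried t \<subseteq> X \<and> (\<forall>\<rho> \<in> rankings X. run t \<rho> = F \<rho>)"

definition worst_case_queries :: "('x, 'r) dtree \<Rightarrow> 'x set \<Rightarrow> nat" where
  "worst_case_queries t X = Max (num_queries t ` rankings X)"

text \<open>The set of correct algorithms is nonempty whenever \<open>X\<close> is finite and \<open>F\<close> depends only
  on the values of the ranking on \<open>X\<close>.\<close>

definition query_complexity :: "'x set \<Rightarrow> (('x \<Rightarrow> nat) \<Rightarrow> 'r) \<Rightarrow> nat" where
  "query_complexity X F = (INF t \<in> {t. computes t X F}. worst_case_queries t X)"

end

(* Fix the order of A and distribute B freely over the gaps between the elements of A, each gap
   sorted in a fixed way. Two such rankings with different distributions g, h never give the same
   answers. Otherwise let x in B lie in gap i of g but lower in h. Reorder the gaps of g internally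
   according to h: each comparison is answered as by g or as by h, so the run of the algorithm is
   unchanged. The lowest element y of gap i now lies directly above the i-th element p of A,
   and y lies below p in h, so exchanging y and p does not change the run either; but it
   increases XInv by 1, so the algorithm errs. Hence a decision tree of depth q has
   m^b <= 2^q when m gaps are available. For MInv = min XInv (ab - XInv), the upper a div 2 + 1 gaps
   keep XInv at or below the middle, where an increment by 1 still changes the minimum. *)

theory Submission imports Defs "HOL-Library.FuncSet" begin

section \<open>Answer sequences of decision trees\<close>

primrec answers :: "('x, 'r) dtree \<Rightarrow> ('x \<Rightarrow> nat) \<Rightarrow> bool list" where
  "answers (Output r) \<rho> = []"
| "answers (Query x y t f) \<rho> = (\<rho> x < \<rho> y) # (if \<rho> x < \<rho> y then answers t \<rho> else answers f \<rho>)"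

lemma length_answers: "length (answers t \<rho>) = num_queries t \<rho>"
  by (induction t) auto

lemma run_cong_answers: "answers t \<rho> = answers t \<sigma> \<Longrightarrow> run t \<rho> = run t \<sigma>"
  by (induction t) (auto split: if_splits)

text \<open>At every query on the common path \<open>\<rho>\<close> and \<open>\<sigma>\<close>
  agree, so \<open>\<tau>\<close> gives the same answer whichever of the two it follows there; the
  choice may vary from pair to pair.\<close>

lemma answers_mixture:
  assumes "answers t \<rho> = answers t \<sigma>"
    and "\<And>x y. x \<in> queried t \<Longrightarrow> y \<in> queried t \<Longrightarrow>
      (\<tau> x < \<tau> y) = (\<rho> x < \<rho> y) \<or> (\<tau> x < \<tau> y) = (\<sigma> x < \<sigma> y)"
  shows "answers t \<tau> = answers t \<rho>"
  using assms
proof (induction t)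
  case (Query x y t f)
  have "(\<rho> x < \<rho> y) = (\<sigma> x < \<sigma> y)" using Query.prems(1) by simp
  moreover have "(\<tau> x < \<tau> y) = (\<rho> x < \<rho> y) \<or> (\<tau> x < \<tau> y) = (\<sigma> x < \<sigma> y)"
    using Query.prems(2)[of x y] by simp
  ultimately have eq: "(\<tau> x < \<tau> y) = (\<rho> x < \<rho> y)" "(\<rho> x < \<rho> y) = (\<sigma> x < \<sigma> y)" by auto
  show ?case
  proof (cases "\<rho> x < \<rho> y")
    case True
    have "answers t \<tau> = answers t \<rho>"
      by (rule Query.IH(1)) (use Query.prems eq True in auto)
    then show ?thesis using True eq by simp
  next
    case False
    have "answers f \<tau> = answers f \<rho>"
      by (rule Query.IH(2)) (use Query.prems eq False in auto)
    then show ?thesis using False eq by simp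
  qed
qed simp

lemma answers_cong:
  assumes "\<And>x y. x \<in> queried t \<Longrightarrow> y \<in> queried t \<Longrightarrow> (\<tau> x < \<tau> y) = (\<rho> x < \<rho> y)"
  shows "answers t \<tau> = answers t \<rho>"
  by (rule answers_mixture[of t \<rho> \<rho>]) (use assms in auto)

text \<open>A binary tree cut at depth \<open>d\<close> has at most \<open>2 ^ d\<close> leaves.
  Depth is bounded on \<open>R\<close> only, and the induction splits \<open>R\<close> by the answer
  at the root, so \<open>R\<close> and \<open>d\<close> have to vary.\<close>

lemma card_answers_le:
  assumes "\<And>\<rho>. \<rho> \<in> R \<Longrightarrow> num_queries t \<rho> \<le> d"
  shows "finite (answers t ` R) \<and> card (answers t ` R) \<le> 2 ^ d"
proof (intro conjI)
  let ?L = "{bs :: bool list. set bs \<subseteq> UNIV \<and> length bs \<le> d}"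
  have "answers t ` R \<subseteq> ?L" using assms by (auto simp: length_answers)
  then show "finite (answers t ` R)"
    using finite_lists_length_le[of "UNIV :: bool set" d] by (simp add: finite_subset)
  show "card (answers t ` R) \<le> 2 ^ d"
    using assms
  proof (induction t arbitrary: R d)
    case (Output r)
    have "card (answers (Output r) ` R) \<le> card {[] :: bool list}" by (rule card_mono) auto
    then have "card (answers (Output r) ` R) \<le> 1" by simp
    also have "\<dots> \<le> 2 ^ d" by simp
    finally show ?case .
  next
    case (Query x y t f)
    let ?R1 = "{\<rho> \<in> R. \<rho> x < \<rho> y}" and ?R2 = "{\<rho> \<in> R. \<not> \<rho> x < \<rho> y}"
    show ?case
    proof (cases "R = {}")
      case False
      \<comment> \<open>A nonempty \<open>R\<close> forces at least one query, so \<open>d\<close>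
        is positive.\<close>
      then obtain d' where d: "d = Suc d'"
        using Query.prems by (cases d) fastforce+
      have "card (answers t ` ?R1) \<le> 2 ^ d'"
        using Query.prems d by (intro Query.IH(1)) fastforce
      moreover have "card (answers f ` ?R2) \<le> 2 ^ d'"
        using Query.prems d by (intro Query.IH(2)) fastforce
      moreover have "R = ?R1 \<union> ?R2" by auto
      then have "answers (Query x y t f) ` R =
          answers (Query x y t f) ` ?R1 \<union> answers (Query x y t f) ` ?R2"
        by (metis image_Un)
      then have "answers (Query x y t f) ` R =
          (#) True ` (answers t ` ?R1) \<union> (#) False ` (answers f ` ?R2)"
        by (simp add: image_image cong: image_cong_simp)
      then have "card (answers (Query x y t f) ` R) \<le>
          card ((#) True ` (answers t ` ?R1)) + card ((#) False ` (answers f ` ?R2))"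
        by (simp add: card_Un_le)
      ultimately show ?thesis using d by (simp add: card_image)
    qed simp
  qed
qed

text \<open>Makes \<open>worst_case_queries\<close> a maximum over a finite set.\<close>

lemma bounded_num_queries: "\<exists>N. \<forall>\<rho>. num_queries t \<rho> \<le> N"
proof (induction t)
  case (Query x y t f)
  then obtain N M where "\<forall>\<rho>. num_queries t \<rho> \<le> N" "\<forall>\<rho>. num_queries f \<rho> \<le> M" by blast
  then have "\<forall>\<rho>. num_queries (Query x y t f) \<rho> \<le> Suc (N + M)"
    by (simp add: le_SucI trans_le_add1 trans_le_add2)
  then show ?case by blast
qed auto

lemma num_queries_le_worst_case:
  assumes "\<rho> \<in> rankings X" shows "num_queries t \<rho> \<le> worst_case_queries t X"
proof -
  obtain N where "\<forall>\<rho>. num_queries t \<rho> \<le> N" using bounded_num_queries by blast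
  then have "num_queries t ` rankings X \<subseteq> {..N}" by auto
  then have "finite (num_queries t ` rankings X)" by (rule finite_subset) simp
  then show ?thesis unfolding worst_case_queries_def using assms by simp
qed

section \<open>Functions determined by comparisons, and optimal trees for them\<close>

text \<open>For finite \<open>X\<close> this ensures that a correct tree exists, so the infimum in
  \<open>query_complexity\<close> is attained. It ranges over all functions, not only rankings, so
  that \<open>F\<close> can be evaluated on keys with gaps.\<close>

definition comparison_based :: "'x set \<Rightarrow> (('x \<Rightarrow> nat) \<Rightarrow> 'r) \<Rightarrow> bool" where
  "comparison_based X F \<longleftrightarrow>
    (\<forall>\<rho> \<sigma>. (\<forall>x\<in>X. \<forall>y\<in>X. (\<rho> x < \<rho> y) = (\<sigma> x < \<sigma> y)) \<longrightarrow> F \<rho> = F \<sigma>)"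

lemma comparison_basedD:
  assumes "comparison_based X F" "\<And>x y. x \<in> X \<Longrightarrow> y \<in> X \<Longrightarrow> (\<rho> x < \<rho> y) = (\<sigma> x < \<sigma> y)"
  shows "F \<rho> = F \<sigma>"
  using assms unfolding comparison_based_def by blast

text \<open>The comparisons are asked in list order whatever the answers; quantifying over
  \<open>G\<close> lets each subtree absorb the first answer into it.\<close>

lemma ex_dtree_of_comparisons:
  assumes "set ps \<subseteq> X \<times> X"
  shows "\<exists>t. queried t \<subseteq> X \<and> (\<forall>\<rho>. run t \<rho> = G (map (\<lambda>(x, y). \<rho> x < \<rho> y) ps))"
  using assms
proof (induction ps arbitrary: G)
  case Nil
  show ?case by (intro exI[of _ "Output (G [])"]) auto
next
  case (Cons p ps)
  obtain x y where p: "p = (x, y)" by (cases p)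
  from Cons obtain t f where "queried t \<subseteq> X" "queried f \<subseteq> X"
    "\<forall>\<rho>. run t \<rho> = G (True # map (\<lambda>(x, y). \<rho> x < \<rho> y) ps)"
    "\<forall>\<rho>. run f \<rho> = G (False # map (\<lambda>(x, y). \<rho> x < \<rho> y) ps)"
    using Cons.IH[of "\<lambda>bs. G (True # bs)"] Cons.IH[of "\<lambda>bs. G (False # bs)"] by auto
  then show ?case using Cons.prems p by (intro exI[of _ "Query x y t f"]) auto
qed

lemma ex_computes:
  assumes "finite X" "comparison_based X F"
  shows "\<exists>t. computes t X F"
proof -
  obtain ps where ps: "set ps = X \<times> X"
    using finite_list[of "X \<times> X"] assms(1) by auto
  let ?c = "\<lambda>\<rho> :: 'a \<Rightarrow> nat. map (\<lambda>(x, y). \<rho> x < \<rho> y) ps"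
  \<comment> \<open>Any function with answer vector \<open>bs\<close> will do: all of them compare
    alike on \<open>X\<close>, hence share the value of \<open>F\<close>.\<close>
  define G where "G bs = F (SOME \<rho>. ?c \<rho> = bs)" for bs
  obtain t where t: "queried t \<subseteq> X" "\<forall>\<rho>. run t \<rho> = G (?c \<rho>)"
    using ex_dtree_of_comparisons[of ps X G] ps by blast
  have "G (?c \<rho>) = F \<rho>" for \<rho>
  proof -
    have "?c (SOME \<sigma>. ?c \<sigma> = ?c \<rho>) = ?c \<rho>"
      by (rule someI[of "\<lambda>\<sigma>. ?c \<sigma> = ?c \<rho>" \<rho>]) (rule refl)
    then have "\<forall>p\<in>X \<times> X. (\<lambda>(x, y). (SOME \<sigma>. ?c \<sigma> = ?c \<rho>) x < (SOME \<sigma>. ?c \<sigma> = ?c \<rho>) y) p =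
        (\<lambda>(x, y). \<rho> x < \<rho> y) p"
      unfolding map_eq_conv ps .
    then show ?thesis
      unfolding G_def by (intro comparison_basedD[OF assms(2)]) blast
  qed
  then show ?thesis using t unfolding computes_def by auto
qed

lemma obtain_optimal_dtree:
  assumes "finite X" "comparison_based X F"
  obtains t where "computes t X F" "worst_case_queries t X = query_complexity X F"
proof -
  have "query_complexity X F \<in> (\<lambda>t. worst_case_queries t X) ` {t. computes t X F}"
    unfolding query_complexity_def using ex_computes[OF assms] by (intro Inf_nat_def1) auto
  then show ?thesis using that by auto
qed

section \<open>Injective keys in place of rankings\<close>

lemma ex_ranking_same_order:
  fixes f :: "'x \<Rightarrow> nat"
  assumes "finite X" "inj_on f X"
  obtains \<rho> where "\<rho> \<in> rankings X" "\<And>x y. x \<in> X \<Longrightarrow> y \<in> X \<Longrightarrow> (\<rho> x < \<rho> y) = (f x < f y)"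
proof -
  \<comment> \<open>Counting \<open>x\<close> itself makes the ranks start at 1.\<close>
  define \<rho> where "\<rho> x = card {y \<in> X. f y \<le> f x}" for x
  have less: "\<rho> x < \<rho> y" if "x \<in> X" "y \<in> X" "f x < f y" for x y
  proof -
    have "y \<in> {z \<in> X. f z \<le> f y}" "y \<notin> {z \<in> X. f z \<le> f x}" using that by auto
    moreover have "{z \<in> X. f z \<le> f x} \<subseteq> {z \<in> X. f z \<le> f y}" using that by auto
    ultimately have "{z \<in> X. f z \<le> f x} \<subset> {z \<in> X. f z \<le> f y}" by blast
    then show ?thesis unfolding \<rho>_def using assms(1) by (intro psubset_card_mono) auto
  qed
  have iff: "(\<rho> x < \<rho> y) = (f x < f y)" if "x \<in> X" "y \<in> X" for x y
    using less[of x y] less[of y x] that assms(2)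
    by (metis inj_on_contraD less_asym' nat_neq_iff)
  have inj: "inj_on \<rho> X"
    using less assms(2) by (intro inj_onI) (metis inj_onD less_irrefl nat_neq_iff)
  have "\<rho> x \<in> {1..card X}" if "x \<in> X" for x
  proof -
    have "{y \<in> X. f y \<le> f x} \<noteq> {}" using that by auto
    then show ?thesis
      unfolding \<rho>_def using assms(1) by (auto simp: card_gt_0_iff Suc_le_eq intro: card_mono)
  qed
  then have "\<rho> ` X = {1..card X}"
    using inj by (intro card_subset_eq) (auto simp: card_image)
  with inj have "\<rho> \<in> rankings X" by (simp add: rankings_def bij_betw_def)
  then show thesis using iff that by blast
qed

text \<open>Correctness and cost are defined on rankings only, while the constructions below use
  keys with gaps. Compressing such keys to a ranking changes no comparison.\<close>

lemma computes_inj_on: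
  assumes "finite X" "comparison_based X F" "computes t X F" "inj_on f X"
  shows "run t f = F f" and "num_queries t f \<le> worst_case_queries t X"
proof -
  obtain \<rho> where \<rho>: "\<rho> \<in> rankings X" "\<And>x y. x \<in> X \<Longrightarrow> y \<in> X \<Longrightarrow> (\<rho> x < \<rho> y) = (f x < f y)"
    using ex_ranking_same_order[OF assms(1,4)] by metis
  have ans: "answers t f = answers t \<rho>"
    using \<rho> assms(3) by (intro answers_cong) (auto simp: computes_def)
  have "run t f = run t \<rho>" using ans by (rule run_cong_answers)
  also have "\<dots> = F \<rho>" using assms(3) \<rho> by (simp add: computes_def)
  also have "\<dots> = F f" using \<rho> by (intro comparison_basedD[OF assms(2)]) auto
  finally show "run t f = F f" .
  show "num_queries t f \<le> worst_case_queries t X"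
    using num_queries_le_worst_case[OF \<rho>(1), of t] ans by (simp flip: length_answers)
qed

section \<open>Lexicographic keys and the exchange argument\<close>

lemma nat_lex_less:
  fixes i j r s m :: nat
  assumes "i < j" "r < m"
  shows "i * m + r < j * m + s"
proof -
  have "i * m + r < Suc i * m" using assms by simp
  also have "\<dots> \<le> j * m" using assms by (intro mult_le_mono1) simp
  finally show ?thesis by simp
qed

lemma nat_lex_less_iff:
  fixes i j r s m :: nat
  assumes "r < m" "s < m"
  shows "i * m + r < j * m + s \<longleftrightarrow> i < j \<or> i = j \<and> r < s"
  using nat_lex_less[of i j r m s] nat_lex_less[of j i s m r] assms
  by (cases i j rule: linorder_cases) auto

text \<open>The key \<open>g y * n + \<beta> y\<close> puts \<open>y\<close> into the gap directly
  above the element of \<open>A\<close> numbered \<open>g y\<close>; gap 0 lies below all of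
  \<open>A\<close>. The function \<open>\<phi>\<close> extracts the output from the number of cross
  inversions, so that counting and tree minimization share the argument.\<close>

lemma bin_rankings_distinguished:
  fixes A B :: "'x set" and \<alpha> \<beta> :: "'x \<Rightarrow> nat" and \<phi> :: "nat \<Rightarrow> 'r"
  assumes fin: "finite A" "finite B" and disj: "A \<inter> B = {}"
    and \<alpha>: "bij_betw \<alpha> A {1..a}" and \<beta>: "inj_on \<beta> B" "\<And>x. x \<in> B \<Longrightarrow> 0 < \<beta> x \<and> \<beta> x < n"
    and g: "\<And>x. x \<in> B \<Longrightarrow> g x \<in> {k..a}" and h: "\<And>x. x \<in> B \<Longrightarrow> h x \<in> {k..a}"
    and comp: "computes t (A \<union> B) F" "comparison_based (A \<union> B) F"
    and F: "\<And>\<rho>. inj_on \<rho> (A \<union> B) \<Longrightarrow> F \<rho> = \<phi> (XInv \<rho> A B)"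
    and \<phi>: "\<And>j. j \<le> card B * (a - k) \<Longrightarrow> \<phi> (Suc j) \<noteq> \<phi> j"
    and less: "x \<in> B" "h x < g x"
  defines "\<rho> \<equiv> \<lambda>g y. if y \<in> A then \<alpha> y * n else g y * n + \<beta> y"
  shows "answers t (\<rho> g) \<noteq> answers t (\<rho> h)"
proof
  assume same: "answers t (\<rho> g) = answers t (\<rho> h)"
  have BA: "y \<notin> A" if "y \<in> B" for y using that disj by auto
  have \<alpha>_inj: "inj_on \<alpha> A" using \<alpha> by (simp add: bij_betw_def)
  have \<alpha>_ne: "\<alpha> y \<noteq> \<alpha> z" if "y \<in> A" "z \<in> A" "y \<noteq> z" for y z
    using \<alpha>_inj that by (auto dest: inj_onD)
  have n: "0 < n" using \<beta>(2)[OF less(1)] by simp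
  have \<rho>A: "\<rho> f y = \<alpha> y * n + 0" if "y \<in> A" for f y using that by (simp add: \<rho>_def)
  have \<rho>B: "\<rho> f y = f y * n + \<beta> y" if "y \<in> B" for f y using that BA by (simp add: \<rho>_def)
  have \<rho>AA: "\<rho> f y < \<rho> f z \<longleftrightarrow> \<alpha> y < \<alpha> z" if "y \<in> A" "z \<in> A" for f y z
    unfolding \<rho>A[OF that(1)] \<rho>A[OF that(2)] using n by (subst nat_lex_less_iff) auto
  have \<rho>AB: "\<rho> f y < \<rho> f z \<longleftrightarrow> \<alpha> y \<le> f z" if "y \<in> A" "z \<in> B" for f y z
    unfolding \<rho>A[OF that(1)] \<rho>B[OF that(2)] using n \<beta>(2)[OF that(2)] by (subst nat_lex_less_iff) auto
  have \<rho>BA: "\<rho> f z < \<rho> f y \<longleftrightarrow> f z < \<alpha> y" if "y \<in> A" "z \<in> B" for f y z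
    unfolding \<rho>A[OF that(1)] \<rho>B[OF that(2)] using n \<beta>(2)[OF that(2)] by (subst nat_lex_less_iff) auto
  have \<rho>BB: "\<rho> f y < \<rho> f z \<longleftrightarrow> f y < f z \<or> f y = f z \<and> \<beta> y < \<beta> z" if "y \<in> B" "z \<in> B" for f y z
    unfolding \<rho>B[OF that(1)] \<rho>B[OF that(2)] using \<beta>(2)[OF that(1)] \<beta>(2)[OF that(2)]
    by (subst nat_lex_less_iff) auto
  have \<rho>inj: "\<rho> f y \<noteq> \<rho> f z" if "y \<in> B" "z \<in> B" "y \<noteq> z" for f y z
    using \<rho>BB[OF that(1,2), of f] \<rho>BB[OF that(2,1), of f] \<beta>(1) that
    by (metis inj_onD less_irrefl nat_neq_iff)
  \<comment> \<open>One more than a lexicographic base requires: all \<open>\<rho> h y\<close> stay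
    below \<open>m - 1\<close>, so remainder \<open>m - 1\<close> remains free for an element moved
    to the top of a gap.\<close>
  define m where "m = Suc (Suc (Max (\<rho> h ` B)))"
  have m: "Suc (\<rho> h y) < m" if "y \<in> B" for y
    unfolding m_def using that fin by (simp add: less_Suc_eq_le)
  have m': "\<rho> h y < m" if "y \<in> B" for y using m[OF that] by simp
  \<comment> \<open>Remainder 0 is reserved for the elements of \<open>A\<close>.\<close>
  have \<rho>pos: "0 < \<rho> h y" if "y \<in> B" for y using that \<beta>(2) by (simp add: \<rho>B)
  have m0: "0 < m" by (simp add: m_def)
  \<comment> \<open>the bins of \<open>g\<close>, each sorted internally as by \<open>\<rho> h\<close>\<close>
  define \<sigma> where "\<sigma> y = (if y \<in> A then \<alpha> y * m else g y * m + \<rho> h y)" for y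
  have \<sigma>A: "\<sigma> y = \<alpha> y * m + 0" if "y \<in> A" for y using that by (simp add: \<sigma>_def)
  have \<sigma>B: "\<sigma> y = g y * m + \<rho> h y" if "y \<in> B" for y using that BA by (simp add: \<sigma>_def)
  have \<sigma>AA: "\<sigma> y < \<sigma> z \<longleftrightarrow> \<alpha> y < \<alpha> z" if "y \<in> A" "z \<in> A" for y z
    unfolding \<sigma>A[OF that(1)] \<sigma>A[OF that(2)] using m0 by (subst nat_lex_less_iff) auto
  have \<sigma>AB: "\<sigma> y < \<sigma> z \<longleftrightarrow> \<alpha> y \<le> g z" if "y \<in> A" "z \<in> B" for y z
    unfolding \<sigma>A[OF that(1)] \<sigma>B[OF that(2)] using m0 m'[OF that(2)] \<rho>pos[OF that(2)]
    by (subst nat_lex_less_iff) auto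
  have \<sigma>BA: "\<sigma> z < \<sigma> y \<longleftrightarrow> g z < \<alpha> y" if "y \<in> A" "z \<in> B" for y z
    unfolding \<sigma>A[OF that(1)] \<sigma>B[OF that(2)] using m0 m'[OF that(2)] by (subst nat_lex_less_iff) auto
  have \<sigma>BB: "\<sigma> y < \<sigma> z \<longleftrightarrow> g y < g z \<or> g y = g z \<and> \<rho> h y < \<rho> h z" if "y \<in> B" "z \<in> B" for y z
    unfolding \<sigma>B[OF that(1)] \<sigma>B[OF that(2)] using m'[OF that(1)] m'[OF that(2)]
    by (subst nat_lex_less_iff) auto
  have \<sigma>inj: "inj_on \<sigma> (A \<union> B)"
  proof (rule inj_onI, rule ccontr)
    fix y z assume yz: "y \<in> A \<union> B" "z \<in> A \<union> B" "\<sigma> y = \<sigma> z" "y \<noteq> z"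
    have "\<sigma> y < \<sigma> z \<or> \<sigma> z < \<sigma> y"
      using yz(1,2,4) \<alpha>_ne[of y z] \<rho>inj[of y z h]
      by (elim UnE) (auto simp: \<sigma>AA \<sigma>AB \<sigma>BA \<sigma>BB nat_neq_iff)
    then show False using yz(3) by simp
  qed
  define i where "i = g x"
  have i: "1 \<le> i" "i \<le> a" using less g[OF less(1)] by (auto simp: i_def)
  \<comment> \<open>The inequality \<open>h x < g x\<close> excludes gap 0, so gap \<open>i\<close>
    has an element of \<open>A\<close> at its lower end.\<close>
  obtain p where p: "p \<in> A" "\<alpha> p = i"
    using \<alpha> i unfolding bij_betw_def by (metis atLeastAtMost_iff imageE)
  \<comment> \<open>Minimality with respect to \<open>\<rho> h\<close> serves twice:
    \<open>y\<close> is lowest in its gap under \<open>\<sigma>\<close>, and in \<open>h\<close> it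
    is no higher than \<open>x\<close>, hence below \<open>p\<close>.\<close>
  have "\<exists>y. (y \<in> B \<and> g y = i) \<and> (\<forall>z. z \<in> B \<and> g z = i \<longrightarrow> \<rho> h y \<le> \<rho> h z)"
    using ex_has_least_nat[of "\<lambda>y. y \<in> B \<and> g y = i" x "\<rho> h"] less by (simp add: i_def)
  then obtain y where y: "y \<in> B" "g y = i" "\<And>z. z \<in> B \<Longrightarrow> g z = i \<Longrightarrow> \<rho> h y \<le> \<rho> h z"
    by blast
  have yp: "\<rho> h y < \<rho> h p"
  proof -
    have "\<rho> h y \<le> \<rho> h x" using y(3) less by (simp add: i_def)
    also have "\<rho> h x < \<rho> h p" using \<rho>BA[OF p(1) less(1)] less p by (simp add: i_def)
    finally show ?thesis .
  qed
  have yA: "y \<notin> A" using y BA by auto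
  \<comment> \<open>moves \<open>y\<close> across \<open>p\<close> and nothing else: bin \<open>i - 1\<close> stays below \<open>i * m - 1\<close> by the choice of \<open>m\<close>\<close>
  define \<tau> where "\<tau> = \<sigma>(y := (i - 1) * m + (m - 1))"
  have \<tau>y: "\<tau> y = (i - 1) * m + (m - 1)" by (simp add: \<tau>_def)
  have \<tau>z: "\<tau> z = \<sigma> z" if "z \<noteq> y" for z using that by (simp add: \<tau>_def)
  have \<tau>yA: "\<tau> y < \<tau> z \<longleftrightarrow> i \<le> \<alpha> z" "\<tau> z < \<tau> y \<longleftrightarrow> \<alpha> z < i" if "z \<in> A" for z
  proof -
    have "z \<noteq> y" using that yA by auto
    then show "\<tau> y < \<tau> z \<longleftrightarrow> i \<le> \<alpha> z" "\<tau> z < \<tau> y \<longleftrightarrow> \<alpha> z < i"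
      unfolding \<tau>y \<tau>z[OF \<open>z \<noteq> y\<close>] \<sigma>A[OF that] using m0 i m[OF y(1)]
      by (subst nat_lex_less_iff; auto)+
  qed
  have \<tau>yB: "\<tau> y < \<tau> z \<longleftrightarrow> i \<le> g z" "\<tau> z < \<tau> y \<longleftrightarrow> g z < i" if "z \<in> B" "z \<noteq> y" for z
    unfolding \<tau>y \<tau>z[OF that(2)] \<sigma>B[OF that(1)] using m0 i m[OF that(1)]
    by (subst nat_lex_less_iff; auto)+
  have \<tau>inj: "inj_on \<tau> (A \<union> B)"
  proof (rule inj_onI, rule ccontr)
    fix u v assume uv: "u \<in> A \<union> B" "v \<in> A \<union> B" "\<tau> u = \<tau> v" "u \<noteq> v"
    have *: "\<tau> y \<noteq> \<tau> z" if "z \<in> A \<union> B" "z \<noteq> y" for z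
      using that \<tau>yA[of z] \<tau>yB[of z] by (metis UnE linorder_not_less nat_neq_iff)
    show False
    proof (cases "u = y \<or> v = y")
      case True then show False using * uv by metis
    next
      case False then show False using uv \<sigma>inj by (auto simp: \<tau>z dest: inj_onD)
    qed
  qed
  have q: "queried t \<subseteq> A \<union> B" using comp by (simp add: computes_def)
  \<comment> \<open>Two elements of \<open>B\<close> in the same gap of \<open>g\<close> compare as
    in \<open>h\<close>, all other pairs as in \<open>g\<close>.\<close>
  have \<sigma>mix: "(\<sigma> u < \<sigma> v) = (\<rho> g u < \<rho> g v) \<or> (\<sigma> u < \<sigma> v) = (\<rho> h u < \<rho> h v)"
    if "u \<in> A \<union> B" "v \<in> A \<union> B" for u v
    using that by (elim UnE) (auto simp: \<sigma>AA \<sigma>AB \<sigma>BA \<sigma>BB \<rho>AA \<rho>AB \<rho>BA \<rho>BB)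
  have \<sigma>ans: "answers t \<sigma> = answers t (\<rho> g)"
    by (rule answers_mixture[OF same]) (use q \<sigma>mix in blast)
  \<comment> \<open>Only the order of \<open>p\<close> and \<open>y\<close> differs from
    \<open>\<sigma>\<close>, and there \<open>\<tau>\<close> agrees with \<open>h\<close>.\<close>
  have \<tau>mix: "(\<tau> u < \<tau> v) = (\<sigma> u < \<sigma> v) \<or> (\<tau> u < \<tau> v) = (\<rho> h u < \<rho> h v)"
    if uv: "u \<in> A \<union> B" "v \<in> A \<union> B" for u v
  proof (cases "u = y \<or> v = y")
    case True
    \<comment> \<open>Both orders of the pair are treated together, since a query may name
      \<open>y\<close> on either side.\<close>
    have *: "(\<tau> y < \<tau> z) = (\<sigma> y < \<sigma> z) \<and> (\<tau> z < \<tau> y) = (\<sigma> z < \<sigma> y)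
      \<or> (\<tau> y < \<tau> z) = (\<rho> h y < \<rho> h z) \<and> (\<tau> z < \<tau> y) = (\<rho> h z < \<rho> h y)"
      if z: "z \<in> A \<union> B" for z
    proof -
      consider "z = p" | "z \<in> A" "z \<noteq> p" | "z = y" | "z \<in> B" "z \<noteq> y" using z by blast
      then show ?thesis
      proof cases
        case 1 then show ?thesis using p yp \<tau>yA[OF p(1)] by simp
      next
        case 2
        then have "\<alpha> z \<noteq> i" using p \<alpha>_inj by (auto dest: inj_onD)
        then show ?thesis using 2(1) y(1,2) \<tau>yA[of z] \<sigma>AB[of z y] \<sigma>BA[of z y] by auto
      next
        case 3 then show ?thesis by simp
      next
        case 4
        then have "g z = i \<Longrightarrow> \<rho> h y < \<rho> h z"
          using y(3)[of z] \<rho>inj[OF y(1), of z h] by (metis le_neq_implies_less)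
        moreover from this have "\<not> (g z = i \<and> \<rho> h z < \<rho> h y)" by linarith
        ultimately have "(\<tau> y < \<tau> z) = (\<sigma> y < \<sigma> z)" "(\<tau> z < \<tau> y) = (\<sigma> z < \<sigma> y)"
          unfolding \<tau>yB[OF 4] \<sigma>BB[OF y(1) 4(1)] \<sigma>BB[OF 4(1) y(1)] y(2) by linarith+
        then show ?thesis by blast
      qed
    qed
    then show ?thesis using True uv by blast
  next
    case False then show ?thesis by (simp add: \<tau>z)
  qed
  have "answers t \<tau> = answers t \<sigma>"
    by (rule answers_mixture[of t \<sigma> "\<rho> h"]) (use q \<tau>mix \<sigma>ans same in auto)
  then have "run t \<tau> = run t \<sigma>" by (rule run_cong_answers)
  then have "\<phi> (XInv \<tau> A B) = \<phi> (XInv \<sigma> A B)"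
    using computes_inj_on(1)[OF _ comp(2,1)] fin \<sigma>inj \<tau>inj F by simp
  moreover have "XInv \<tau> A B = Suc (XInv \<sigma> A B)"
  proof -
    have "{(u, v) \<in> A \<times> B. \<tau> u > \<tau> v} = insert (p, y) {(u, v) \<in> A \<times> B. \<sigma> u > \<sigma> v}"
    proof -
      have "\<tau> u > \<tau> v \<longleftrightarrow> \<sigma> u > \<sigma> v \<or> (u, v) = (p, y)" if uv: "u \<in> A" "v \<in> B" for u v
      proof (cases "v = y")
        case True
        then show ?thesis
          using uv p y \<alpha>_inj \<tau>yA[OF uv(1)] \<sigma>BA[OF uv] by (auto dest: inj_onD)
      next
        case False
        moreover have "u \<noteq> y" using uv yA by auto
        ultimately show ?thesis by (simp add: \<tau>z)
      qed
      then show ?thesis using p y by auto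
    qed
    moreover have "(p, y) \<notin> {(u, v) \<in> A \<times> B. \<sigma> u > \<sigma> v}" using \<sigma>BA[OF p(1) y(1)] p y by simp
    moreover have "finite {(u, v) \<in> A \<times> B. \<sigma> u > \<sigma> v}"
      by (rule finite_subset[of _ "A \<times> B"]) (use fin in auto)
    ultimately show ?thesis by (simp add: XInv_def)
  qed
  moreover have "XInv \<sigma> A B \<le> card B * (a - k)"
  proof -
    let ?A = "{u \<in> A. k < \<alpha> u}"
    have "{(u, v) \<in> A \<times> B. \<sigma> u > \<sigma> v} \<subseteq> ?A \<times> B"
      using g by (fastforce simp: \<sigma>BA)
    then have "XInv \<sigma> A B \<le> card (?A \<times> B)"
      unfolding XInv_def using fin by (intro card_mono) auto
    moreover have "\<alpha> ` ?A \<subseteq> {k<..a}" using \<alpha> by (auto simp: bij_betw_def)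
    then have "card ?A \<le> a - k"
      using card_inj_on_le[of \<alpha> ?A "{k<..a}"] \<alpha>_inj by (auto intro: inj_on_subset)
    ultimately show ?thesis
      by (metis card_cartesian_product mult.commute mult_le_mono2 order_trans)
  qed
  ultimately show False using \<phi> by auto
qed

section \<open>Counting the distinguished rankings\<close>

text \<open>Each element of \<open>B\<close> chooses one of the gaps \<open>k\<close> to
  \<open>card A\<close>, and different choices reach different leaves of an optimal tree. A larger
  \<open>k\<close> costs gaps but demands less of \<open>\<phi>\<close>.\<close>

lemma power_le_query_complexity:
  fixes A B :: "'x set" and \<phi> :: "nat \<Rightarrow> 'r"
  assumes fin: "finite A" "finite B" and disj: "A \<inter> B = {}"
    and k: "k \<le> card A"
    and comp: "comparison_based (A \<union> B) F"
    and F: "\<And>\<rho>. inj_on \<rho> (A \<union> B) \<Longrightarrow> F \<rho> = \<phi> (XInv \<rho> A B)"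
    and \<phi>: "\<And>j. j \<le> card B * (card A - k) \<Longrightarrow> \<phi> (Suc j) \<noteq> \<phi> j"
  shows "Suc (card A - k) ^ card B \<le> 2 ^ query_complexity (A \<union> B) F"
proof -
  let ?a = "card A"
  obtain t where t: "computes t (A \<union> B) F"
    "worst_case_queries t (A \<union> B) = query_complexity (A \<union> B) F"
    using obtain_optimal_dtree[OF _ comp] fin by blast
  obtain \<alpha> where \<alpha>: "bij_betw \<alpha> A {1..?a}"
    using finite_same_card_bij[of A "{1..?a}"] fin by auto
  obtain \<beta> where \<beta>: "bij_betw \<beta> B {1..card B}"
    using finite_same_card_bij[of B "{1..card B}"] fin by auto
  define n where "n = Suc (card B)"
  have \<beta>': "inj_on \<beta> B" "\<And>x. x \<in> B \<Longrightarrow> 0 < \<beta> x \<and> \<beta> x < n"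
    using bij_betw_imp_inj_on[OF \<beta>] bij_betwE[OF \<beta>] by (auto simp: n_def Suc_le_eq less_Suc_eq_le)
  define \<rho> where "\<rho> \<equiv> \<lambda>g y. if y \<in> A then \<alpha> y * n else g y * n + \<beta> y"
  \<comment> \<open>Extensional functions, so that distinct members differ on \<open>B\<close> and
    can be counted.\<close>
  let ?G = "B \<rightarrow>\<^sub>E {k..?a}"
  have inj_\<rho>: "inj_on (\<rho> g) (A \<union> B)" for g
  proof (rule inj_onI)
    fix y z assume yz: "y \<in> A \<union> B" "z \<in> A \<union> B" "\<rho> g y = \<rho> g z"
    have A: "\<rho> g u = \<alpha> u * n + 0" if "u \<in> A" for u using that by (simp add: \<rho>_def)
    \<comment> \<open>Residues modulo \<open>n\<close> tell \<open>A\<close> from \<open>B\<close>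
      and the elements of \<open>B\<close> from each other, since \<open>\<beta>\<close> takes
      distinct values strictly between 0 and \<open>n\<close>.\<close>
    have mod: "\<rho> g u mod n = (if u \<in> A then 0 else \<beta> u)" if "u \<in> A \<union> B" for u
      using that \<beta>'(2) by (auto simp: \<rho>_def)
    have "(if y \<in> A then 0 else \<beta> y) = (if z \<in> A then 0 else \<beta> z)"
      using mod[OF yz(1)] mod[OF yz(2)] yz(3) by simp
    then consider "y \<in> A" "z \<in> A" | "y \<in> B" "z \<in> B" "\<beta> y = \<beta> z"
      using yz(1,2) \<beta>'(2)[of y] \<beta>'(2)[of z] by (auto split: if_splits)
    then show "y = z"
    proof cases
      case 1
      then have "\<alpha> y = \<alpha> z" using yz(3) by (simp add: A n_def del: mult_Suc_right)
      then show ?thesis using 1 \<alpha> by (auto simp: bij_betw_def dest: inj_onD)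
    next
      case 2 then show ?thesis using \<beta>' by (auto dest: inj_onD)
    qed
  qed
  have dist: "answers t (\<rho> g) \<noteq> answers t (\<rho> h)"
    if "g \<in> ?G" "h \<in> ?G" "x \<in> B" "h x < g x" for g h x
    using bin_rankings_distinguished[OF fin disj \<alpha> \<beta>', where k = k and g = g and h = h and x = x]
      PiE_mem[OF that(1)] PiE_mem[OF that(2)] t(1) comp F \<phi> that(3,4)
    unfolding \<rho>_def by blast
  have "inj_on (\<lambda>g. answers t (\<rho> g)) ?G"
  proof (rule inj_onI, rule ccontr)
    fix g h assume gh: "g \<in> ?G" "h \<in> ?G" "answers t (\<rho> g) = answers t (\<rho> h)" "g \<noteq> h"
    then obtain x where "x \<in> B" "g x \<noteq> h x" by (metis PiE_ext)
    \<comment> \<open>If \<open>g x < h x\<close>, then \<open>g\<close> and \<open>h\<close>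
      exchange roles.\<close>
    then show False using dist gh by (metis nat_neq_iff)
  qed
  then have "card ?G = card (answers t ` \<rho> ` ?G)"
    by (simp add: card_image image_image)
  also have "\<dots> \<le> 2 ^ worst_case_queries t (A \<union> B)"
    by (rule card_answers_le[THEN conjunct2])
      (use computes_inj_on(2)[OF _ comp t(1) inj_\<rho>] fin in auto)
  finally show ?thesis using fin k t(2) by (simp add: card_PiE Suc_diff_le)
qed

text \<open>With \<open>a div 2 + 1\<close> gaps, at least the square root of \<open>a\<close>, the
  counting bound gives \<open>b * log 2 a \<le> 2 * q\<close>. Replacing \<open>b\<close> by half of
  \<open>a + b\<close> costs another factor 2, whence 1/4.\<close>

lemma query_complexity_lower_bound:
  fixes A B :: "'x set" and \<phi> :: "nat \<Rightarrow> 'r"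
  assumes fin: "finite A" "finite B" and disj: "A \<inter> B = {}"
    and a: "1 \<le> card A" "card A \<le> card B"
    and comp: "comparison_based (A \<union> B) F"
    and F: "\<And>\<rho>. inj_on \<rho> (A \<union> B) \<Longrightarrow> F \<rho> = \<phi> (XInv \<rho> A B)"
    and \<phi>: "\<And>j. j \<le> card B * (card A div 2) \<Longrightarrow> \<phi> (Suc j) \<noteq> \<phi> j"
  shows "1 / 4 * (real (card A) + real (card B)) * log 2 (real (card A))
    \<le> real (query_complexity (A \<union> B) F)"
proof -
  let ?a = "card A" and ?b = "card B" and ?q = "query_complexity (A \<union> B) F"
  have "?a - (?a - ?a div 2) = ?a div 2" by simp
  then have "Suc (?a div 2) ^ ?b \<le> 2 ^ ?q"
    using power_le_query_complexity[OF fin disj _ comp F, of "?a - ?a div 2"] \<phi> by auto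
  moreover have "?a \<le> (Suc (?a div 2))\<^sup>2"
  proof -
    have "?a \<le> 2 * Suc (?a div 2) - 1" by simp
    also have "\<dots> \<le> (Suc (?a div 2))\<^sup>2" by (simp add: power2_eq_square)
    finally show ?thesis .
  qed
  then have "?a ^ ?b \<le> (Suc (?a div 2) ^ ?b)\<^sup>2"
    by (metis power_mono power_commutes power_mult mult.commute le0)
  ultimately have "?a ^ ?b \<le> (2 ^ ?q)\<^sup>2"
    by (meson order_trans power_mono le0)
  then have "real ?a ^ ?b \<le> 2 ^ (2 * ?q)"
    by (metis mult.commute of_nat_le_iff of_nat_numeral of_nat_power power_mult)
  then have "log 2 (real ?a ^ ?b) \<le> log 2 (2 ^ (2 * ?q))"
    using a by (subst log_le_cancel_iff) auto
  then have "real ?b * log 2 (real ?a) \<le> 2 * real ?q"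
    using a by (simp add: log_nat_power)
  \<comment> \<open>Here \<open>a \<le> b\<close> enters; the logarithm is nonnegative because
    \<open>a\<close> is at least 1.\<close>
  moreover have "(real ?a + real ?b) * log 2 (real ?a) \<le> (2 * real ?b) * log 2 (real ?a)"
    using a by (intro mult_right_mono) auto
  ultimately show ?thesis by simp
qed

section \<open>Inversion minimization on the tree of two stars\<close>

lemma list_ranking_append:
  "list_ranking (xs @ ys) x =
    (if x \<in> set xs then list_ranking xs x else length xs + list_ranking ys x)"
  by (induction xs) (auto simp: list_ranking_def)

lemma list_ranking_le_length: "x \<in> set xs \<Longrightarrow> list_ranking xs x \<le> length xs"
  by (induction xs) (auto simp: list_ranking_def)

lemma sorted_list_ranking_less:
  assumes "sorted (map \<rho> xs)" "x \<in> set xs" "y \<in> set xs" "list_ranking xs x < list_ranking xs y"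
  shows "\<rho> x \<le> \<rho> y"
  using assms by (induction xs) (auto simp: list_ranking_def split: if_splits)

text \<open>All of \<open>A\<close> precedes all of \<open>B\<close> in the list, so swapping the
  components turns each cross inversion into an inversion.\<close>

lemma inversions_append_ge:
  assumes "finite A" "finite B" "A \<inter> B = {}" "set us = A" "set vs = B"
  shows "XInv \<rho> A B \<le> inversions (A \<union> B) \<rho> (list_ranking (us @ vs))"
proof -
  have less: "list_ranking (us @ vs) u < list_ranking (us @ vs) v" if "u \<in> A" "v \<in> B" for u v
  proof -
    have "v \<notin> set us" using that assms by auto
    moreover have "list_ranking us u \<le> length us" "0 < list_ranking vs v"
      using that assms by (auto simp: list_ranking_le_length) (simp add: list_ranking_def)
    ultimately show ?thesis using that assms by (simp add: list_ranking_append)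
  qed
  show ?thesis
    unfolding XInv_def inversions_def
  proof (rule card_inj_on_le[where f = prod.swap])
    show "prod.swap ` {(u, v) \<in> A \<times> B. \<rho> v < \<rho> u} \<subseteq> {(x, y) \<in> (A \<union> B) \<times> (A \<union> B).
        \<rho> x < \<rho> y \<and> list_ranking (us @ vs) y < list_ranking (us @ vs) x}"
      using less by auto
    show "finite {(x, y) \<in> (A \<union> B) \<times> (A \<union> B).
        \<rho> x < \<rho> y \<and> list_ranking (us @ vs) y < list_ranking (us @ vs) x}"
      by (rule finite_subset[of _ "(A \<union> B) \<times> (A \<union> B)"]) (use assms in auto)
  qed (auto simp: inj_on_def)
qed

text \<open>Sorted blocks have no inversions inside, so every inversion comes from a cross inversion
  with its components swapped.\<close>

lemma inversions_sorted_append_le: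
  assumes "finite A" "finite B" "A \<inter> B = {}" "set us = A" "set vs = B"
    "sorted (map \<rho> us)" "sorted (map \<rho> vs)"
  shows "inversions (A \<union> B) \<rho> (list_ranking (us @ vs)) \<le> XInv \<rho> A B"
  unfolding XInv_def inversions_def
proof (rule card_inj_on_le[where f = prod.swap])
  show "prod.swap ` {(x, y) \<in> (A \<union> B) \<times> (A \<union> B).
      \<rho> x < \<rho> y \<and> list_ranking (us @ vs) y < list_ranking (us @ vs) x}
      \<subseteq> {(u, v) \<in> A \<times> B. \<rho> v < \<rho> u}"
  proof clarsimp
    fix u v assume uv: "u \<in> A \<or> u \<in> B" "v \<in> A \<or> v \<in> B" "\<rho> v < \<rho> u"
      "list_ranking (us @ vs) u < list_ranking (us @ vs) v"
    consider "u \<in> A" "v \<in> A" | "u \<in> B" "v \<in> B" | "u \<in> B" "v \<in> A" | "u \<in> A" "v \<in> B"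
      using uv by blast
    then show "u \<in> A \<and> v \<in> B"
    proof cases
      case 1
      then show ?thesis using sorted_list_ranking_less[OF assms(6), of u v] uv assms(4)
        by (auto simp: list_ranking_append)
    next
      case 2
      then have "u \<notin> set us" "v \<notin> set us" using assms by auto
      then show ?thesis using 2 sorted_list_ranking_less[OF assms(7), of u v] uv assms(5)
        by (auto simp: list_ranking_append)
    next
      case 3
      then have "u \<notin> set us" "v \<in> set us" using assms by auto
      then show ?thesis using uv list_ranking_le_length[of v us]
        by (auto simp: list_ranking_append)
    qed simp
  qed
  show "finite {(u, v) \<in> A \<times> B. \<rho> v < \<rho> u}"
    by (rule finite_subset[of _ "A \<times> B"]) (use assms in auto)
qed (auto simp: inj_on_def)

lemma leaf_order_Leaf_iff: "leaf_order (Leaf x) xs \<longleftrightarrow> xs = [x]"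
  by (auto elim: leaf_order.cases intro: leaf_order.intros)

lemma list_all2_leaf_order_Leaf:
  "list_all2 leaf_order (map Leaf us) xss \<longleftrightarrow> xss = map (\<lambda>u. [u]) us"
  by (induction us arbitrary: xss) (auto simp: list_all2_Cons1 leaf_order_Leaf_iff)

text \<open>Every child contributes a one-element block, so ordering the children amounts to listing
  \<open>M\<close> in any order.\<close>

lemma leaf_order_star_iff:
  "leaf_order (Node (image_mset Leaf M)) xs \<longleftrightarrow> mset xs = M"
proof
  assume "leaf_order (Node (image_mset Leaf M)) xs"
  then obtain ts xss where ts: "mset ts = image_mset Leaf M" "list_all2 leaf_order ts xss"
    "xs = concat xss"
    by (cases rule: leaf_order.cases) auto
  from ts(1) have "\<exists>us. ts = map Leaf us \<and> mset us = M"
  proof (induction ts arbitrary: M)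
    case (Cons t ts)
    then have "t \<in># image_mset Leaf M" by (metis list.set_intros(1) set_mset_mset)
    then obtain u where u: "u \<in># M" "t = Leaf u" by auto
    then obtain M' where M': "M = add_mset u M'" by (metis insert_DiffM)
    then obtain us where "ts = map Leaf us \<and> mset us = M'" using Cons u by auto
    then show ?case using u M' by (intro exI[of _ "u # us"]) auto
  qed auto
  then show "mset xs = M" using ts(2,3) by (auto simp: list_all2_leaf_order_Leaf)
next
  assume "mset xs = M"
  then have "leaf_order (Node (image_mset Leaf M)) (concat (map (\<lambda>u. [u]) xs))"
    by (intro leaf_order.Node[of "map Leaf xs"]) (auto simp: list_all2_leaf_order_Leaf)
  then show "leaf_order (Node (image_mset Leaf M)) xs" by simp
qed

lemma leaf_order_pair_iff:
  "leaf_order (Node {#S, T#}) xs \<longleftrightarrow>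
    (\<exists>us vs. leaf_order S us \<and> leaf_order T vs \<and> (xs = us @ vs \<or> xs = vs @ us))"
proof
  assume "leaf_order (Node {#S, T#}) xs"
  then obtain ts xss where ts: "mset ts = {#S, T#}" "list_all2 leaf_order ts xss" "xs = concat xss"
    by (cases rule: leaf_order.cases) auto
  have "length ts = Suc (Suc 0)" using ts(1) by (simp flip: size_mset)
  then obtain U V where "ts = [U, V]" by (auto simp: length_Suc_conv)
  then have "ts = [S, T] \<or> ts = [T, S]" using ts(1) by (auto simp: add_eq_conv_ex)
  then show "\<exists>us vs. leaf_order S us \<and> leaf_order T vs \<and> (xs = us @ vs \<or> xs = vs @ us)"
  proof
    assume "ts = [S, T]"
    then obtain us vs where "leaf_order S us" "leaf_order T vs" "xs = us @ vs"
      using ts(2,3) by (auto simp: list_all2_Cons1)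
    then show ?thesis by (intro exI[of _ us] exI[of _ vs]) simp
  next
    assume "ts = [T, S]"
    then obtain us vs where "leaf_order S us" "leaf_order T vs" "xs = vs @ us"
      using ts(2,3) by (auto simp: list_all2_Cons1)
    then show ?thesis by (intro exI[of _ us] exI[of _ vs]) simp
  qed
next
  assume "\<exists>us vs. leaf_order S us \<and> leaf_order T vs \<and> (xs = us @ vs \<or> xs = vs @ us)"
  then obtain us vs where "leaf_order S us" "leaf_order T vs" "xs = us @ vs \<or> xs = vs @ us" by blast
  then show "leaf_order (Node {#S, T#}) xs"
    using leaf_order.Node[of "[S, T]" "{#S, T#}" "[us, vs]"]
      leaf_order.Node[of "[T, S]" "{#S, T#}" "[vs, us]"]
    by (auto simp: add_mset_commute)
qed

lemma leaves_two_star_tree: "finite A \<Longrightarrow> finite B \<Longrightarrow> leaves (two_star_tree A B) = A \<union> B"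
  by (auto simp: two_star_tree_def)

text \<open>Injectivity excludes ties, so each pair in \<open>A \<times> B\<close> is counted
  exactly once.\<close>

lemma XInv_complement:
  assumes "finite A" "finite B" "A \<inter> B = {}" "inj_on \<rho> (A \<union> B)"
  shows "XInv \<rho> A B + XInv \<rho> B A = card A * card B"
proof -
  let ?P = "{(u, v) \<in> A \<times> B. \<rho> u > \<rho> v}" and ?Q = "{(u, v) \<in> A \<times> B. \<rho> v > \<rho> u}"
  have fin: "finite ?P" "finite ?Q"
    by (rule finite_subset[of _ "A \<times> B"]; use assms in auto)+
  have ne: "\<rho> u \<noteq> \<rho> v" if "u \<in> A" "v \<in> B" for u v
    using that assms by (metis Un_iff disjoint_iff inj_onD)
  have "XInv \<rho> B A = card (prod.swap ` {(v, u) \<in> B \<times> A. \<rho> v > \<rho> u})"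
    unfolding XInv_def by (simp add: card_image)
  also have "prod.swap ` {(v, u) \<in> B \<times> A. \<rho> v > \<rho> u} = ?Q" by force
  finally have "XInv \<rho> A B + XInv \<rho> B A = card ?P + card ?Q" by (simp add: XInv_def)
  also have "\<dots> = card (?P \<union> ?Q)"
    using fin by (intro card_Un_disjoint[symmetric]) auto
  also have "?P \<union> ?Q = A \<times> B" using ne by (force simp: nat_neq_iff)
  finally show ?thesis by (simp add: card_cartesian_product)
qed

text \<open>An ordering decides which star comes first and how each is arranged. Sorting inside the
  stars is optimal for either decision, which leaves two candidate values.\<close>

lemma MInv_two_star_tree:
  assumes "finite A" "finite B" "A \<inter> B = {}"
  shows "MInv (two_star_tree A B) \<rho> = min (XInv \<rho> A B) (XInv \<rho> B A)"
proof -
  let ?I = "\<lambda>xs. inversions (A \<union> B) \<rho> (list_ranking xs)"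
  let ?L = "{xs. leaf_order (two_star_tree A B) xs}"
  have L: "xs \<in> ?L \<longleftrightarrow> (\<exists>us vs. mset us = mset_set A \<and> mset vs = mset_set B \<and>
      (xs = us @ vs \<or> xs = vs @ us))" for xs
    by (simp add: two_star_tree_def leaf_order_pair_iff leaf_order_star_iff)
  have set: "set us = C" if "mset us = mset_set C" "finite C" for us and C :: "'a set"
    using that by (metis finite_set_mset_mset_set set_mset_mset)
  obtain us where us: "mset us = mset_set A" "sorted (map \<rho> us)"
    by (metis ex_mset mset_sort sorted_sort_key)
  obtain vs where vs: "mset vs = mset_set B" "sorted (map \<rho> vs)"
    by (metis ex_mset mset_sort sorted_sort_key)
  have uv: "set us = A" "set vs = B" using set us vs assms by auto
  have in_L: "us @ vs \<in> ?L" "vs @ us \<in> ?L" using L us vs by blast+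
  have "MInv (two_star_tree A B) \<rho> = Inf (?I ` ?L)"
    using assms by (simp add: MInv_def leaves_two_star_tree)
  also have "\<dots> = min (XInv \<rho> A B) (XInv \<rho> B A)"
  proof (rule antisym)
    have "Inf (?I ` ?L) \<le> ?I (us @ vs)" using in_L by (intro cInf_lower) auto
    also have "\<dots> \<le> XInv \<rho> A B" using inversions_sorted_append_le assms uv us vs by metis
    finally have 1: "Inf (?I ` ?L) \<le> XInv \<rho> A B" .
    have "Inf (?I ` ?L) \<le> ?I (vs @ us)" using in_L by (intro cInf_lower) auto
    also have "\<dots> \<le> XInv \<rho> B A"
      using inversions_sorted_append_le[of B A vs us \<rho>] assms uv us vs
      by (simp add: Un_commute Int_commute)
    finally show "Inf (?I ` ?L) \<le> min (XInv \<rho> A B) (XInv \<rho> B A)" using 1 by simp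
    have "min (XInv \<rho> A B) (XInv \<rho> B A) \<le> ?I xs" if xs_L: "xs \<in> ?L" for xs
    proof -
      obtain us vs where "mset us = mset_set A" "mset vs = mset_set B"
        and xs: "xs = us @ vs \<or> xs = vs @ us" using L[THEN iffD1, OF xs_L] by metis
      then have "set us = A" "set vs = B" using set assms by auto
      then have "XInv \<rho> A B \<le> ?I (us @ vs)" "XInv \<rho> B A \<le> ?I (vs @ us)"
        using inversions_append_ge[of A B us vs \<rho>] inversions_append_ge[of B A vs us \<rho>] assms
        by (simp_all add: Un_commute Int_commute)
      then show ?thesis using xs by auto
    qed
    then show "min (XInv \<rho> A B) (XInv \<rho> B A) \<le> Inf (?I ` ?L)"
      using in_L by (intro cInf_greatest) auto
  qed
  finally show ?thesis .
qed

section \<open>The lower bound for both problems\<close>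

lemma comparison_based_XInv: "comparison_based (A \<union> B) (\<lambda>\<rho>. XInv \<rho> A B)"
  unfolding comparison_based_def XInv_def
  by (intro allI impI arg_cong[where f = card]) auto

lemma comparison_based_MInv: "comparison_based (leaves T) (MInv T)"
proof -
  have "inversions (leaves T) \<rho> = inversions (leaves T) \<sigma>"
    if "\<forall>x\<in>leaves T. \<forall>y\<in>leaves T. (\<rho> x < \<rho> y) = (\<sigma> x < \<sigma> y)" for \<rho> \<sigma>
    unfolding inversions_def using that by (intro ext arg_cong[where f = card]) auto
  then show ?thesis unfolding comparison_based_def MInv_def by metis
qed

text \<open>Below \<open>a * b\<close>, the minimum stays the same only for
  \<open>2 * j + 1 = a * b\<close>. Parity excludes this for even \<open>a\<close>; for odd
  \<open>a\<close>, the bound on \<open>j\<close> leaves \<open>2 * j\<close> at least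
  \<open>b > 1\<close> short of \<open>a * b\<close>.\<close>

lemma min_complement_Suc_neq:
  fixes a b j :: nat
  assumes "1 < a" "a \<le> b" "j \<le> b * (a div 2)"
  shows "min (Suc j) (a * b - Suc j) \<noteq> min j (a * b - j)"
proof -
  have "Suc (2 * j) \<noteq> a * b"
  proof (cases "even a")
    case True
    then have "even (a * b)" by simp
    then show ?thesis by (metis even_Suc dvd_triv_left)
  next
    case False
    then obtain c where c: "a = 2 * c + 1" by (elim oddE)
    then have "a * b = 2 * (b * (a div 2)) + b" by (simp add: algebra_simps)
    then show ?thesis using assms by linarith
  qed
  moreover have "2 * (b * (a div 2)) \<le> b * a"
    by (metis mult.left_commute mult_le_mono2 times_div_less_eq_dividend)
  then have "2 * (b * (a div 2)) \<le> a * b" by (simp only: mult.commute)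
  then have "2 * j \<le> a * b" using assms(3) by linarith
  \<comment> \<open>From \<open>a * b\<close> on, truncated subtraction would make both minima
    0.\<close>
  moreover have "0 < a * b" using assms by simp
  then have "j < a * b" using \<open>2 * j \<le> a * b\<close> by linarith
  ultimately show ?thesis by (auto simp: min_def)
qed

theorem mainTheorem4:
  shows "(\<exists>c::real. c > 0 \<and> (\<forall>(A::'x set) B a b.
            finite A \<longrightarrow> finite B \<longrightarrow> A \<inter> B = {} \<longrightarrow> card A = a \<longrightarrow> card B = b \<longrightarrow>
            1 \<le> a \<longrightarrow> a \<le> b \<longrightarrow>
            real (query_complexity (A \<union> B) (\<lambda>\<rho>. XInv \<rho> A B))
              \<ge> c * (real a + real b) * log 2 (real a)))
       \<and> (\<exists>c::real. c > 0 \<and> (\<forall>(A::'x set) B a b.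
            finite A \<longrightarrow> finite B \<longrightarrow> A \<inter> B = {} \<longrightarrow> card A = a \<longrightarrow> card B = b \<longrightarrow>
            1 \<le> a \<longrightarrow> a \<le> b \<longrightarrow>
            real (query_complexity (A \<union> B) (MInv (two_star_tree A B)))
              \<ge> c * (real a + real b) * log 2 (real a)))"
proof (intro conjI; rule exI[of _ "1 / 4"]; intro conjI allI impI)
  fix A B :: "'x set" and a b :: nat
  assume ab: "finite A" "finite B" "A \<inter> B = {}" "card A = a" "card B = b" "1 \<le> a" "a \<le> b"
  show "1 / 4 * (real a + real b) * log 2 (real a)
      \<le> real (query_complexity (A \<union> B) (\<lambda>\<rho>. XInv \<rho> A B))"
    using query_complexity_lower_bound[OF ab(1-3) _ _ comparison_based_XInv, of "\<lambda>j. j"] ab by simp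
  show "1 / 4 * (real a + real b) * log 2 (real a)
      \<le> real (query_complexity (A \<union> B) (MInv (two_star_tree A B)))"
  \<comment> \<open>For \<open>a = 1\<close> the logarithm vanishes and the bound is trivial; the
    minimum need not change there, as \<open>a = b = 1\<close> and \<open>j = 0\<close>
    show.\<close>
  proof (cases "a = 1")
    case False
    have comp: "comparison_based (A \<union> B) (MInv (two_star_tree A B))"
      using comparison_based_MInv[of "two_star_tree A B"] ab by (simp add: leaves_two_star_tree)
    \<comment> \<open>The complement identity makes the output a function of
      \<open>XInv \<rho> A B\<close> alone, as the general bound demands.\<close>
    have "MInv (two_star_tree A B) \<rho> = min (XInv \<rho> A B) (a * b - XInv \<rho> A B)"
      if "inj_on \<rho> (A \<union> B)" for \<rho>
      using MInv_two_star_tree[OF ab(1-3), of \<rho>] XInv_complement[OF ab(1-3) that] ab(4,5)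
      by (metis add_diff_cancel_left')
    then show ?thesis
      using query_complexity_lower_bound[OF ab(1-3) _ _ comp, of "\<lambda>j. min j (a * b - j)"]
        min_complement_Suc_neq[of a b] ab False by simp
  qed simp
qed simp_all

end
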